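(* Let $\mathcal X$ be an RD-space and let $\rho$ be an admissible function on $\mathcal X$. For $f\in L^1_{\rm loc}(\mathcal X)$ and $x\in\mathcal X$ let $M_\rho(f)(x)=\sup_{x\in B,\,B\notin\mathcal D}f_B$, the supremum being over all balls $B$ containing $x$ and not belonging to the collection $\mathcal D$ of balls $B(z,r)$ with $r\ge\rho(z)$. Then $M_\rho$ is bounded from $\mathrm{BMO}_\rho(\mathcal X)$ to $\mathrm{BLO}_\rho(\mathcal X)$; namely, there exists a positive constant $C$ such that for all $f\in\mathrm{BMO}_\rho(\mathcal X)$, $M_\rho(f)\in\mathrm{BLO}_\rho(\mathcal X)$ and $$\|M_\rho(f)\|_{\mathrm{BLO}_\rho(\mathcal X)}\le C\|f\|_{\mathrm{BMO}_\rho(\mathcal X)}.$$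
   Context: RD-space: $(\mathcal X,d)$ is a metric space with a regular Borel measure $\mu$ such that all balls $B(x,r)=\{y: d(x,y)<r\}$ have finite and positive measure; $\mu$ is doubling, i.e. there is $A_1\ge1$ with $\mu(B(x,2r))\le A_1\mu(B(x,r))$ for all $x\in\mathcal X$, $r>0$; and there are $0<\kappa\le n$, $A_2\in(0,1]$, $A_3\in[1,\infty)$ such that $A_2\lambda^\kappa\mu(B(x,r))\le\mu(B(x,\lambda r))\le A_3\lambda^n\mu(B(x,r))$ for all $x\in\mathcal X$, $0<r\le \mathrm{diam}(\mathcal X)/2$ and $1\le\lambda\le \mathrm{diam}(\mathcal X)/(2r)$. Balls are understood together with their center and radius. Admissible function: $\rho:\mathcal X\to(0,\infty)$ is admissible if there are positive constants $C_0,k_0$ such that $\frac1{\rho(x)}\le C_0\frac1{\rho(y)}\left(1+\frac{d(x,y)}{\rho(y)}\right)^{k_0}$ for all $x,y\in\mathcal X$. Functions here are real-valued; $L^1_{\rm loc}(\mathcal X)$ means integrable on every ball; $f_B=\frac1{\mu(B)}\int_B f\,d\mu$. With $\mathcal D$ the collection of balls $B(x,r)$ with $r\ge\rho(x)$, the spaces consist of the $f\in L^1_{\rm loc}(\mathcal X)$ for which the following are finite: $$\|f\|_{\mathrm{BMO}_\rho(\mathcal X)}=\sup_{B\notin\mathcal D}\frac1{\mu(B)}\int_B|f-f_B|\,d\mu+\sup_{B\in\mathcal D}\frac1{\mu(B)}\int_B|f|\,d\mu,$$ $$\|f\|_{\mathrm{BLO}_\rho(\mathcal X)}=\sup_{B\notin\mathcal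 D}\frac1{\mu(B)}\int_B\left[f-\operatorname*{ess\,inf}_B f\right]d\mu+\sup_{B\in\mathcal D}\frac1{\mu(B)}\int_B|f|\,d\mu.$$ *)

theory Defs
  imports "HOL-Analysis.Analysis"
begin

definition ediam :: "'a::metric_space set \<Rightarrow> ennreal" where
  "ediam S = (SUP (x, y)\<in>S \<times> S. ennreal (dist x y))"

text \<open>Regularity in the sense customary on metric spaces: inner approximation is by closed
  sets. Compact-inner regularity would be more restrictive on incomplete spaces.\<close>

definition regular_borel_measure :: "'a::metric_space measure \<Rightarrow> bool" where
  "regular_borel_measure M \<longleftrightarrow> sets M = sets borel \<and>
     (\<forall>A\<in>sets M. emeasure M A = (INF U\<in>{U. open U \<and> A \<subseteq> U}. emeasure M U) \<and>
                  emeasure M A = (SUP K\<in>{K. closed K \<and> K \<subseteq> A}. emeasure M K))"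

definition doubling_measure :: "'a::metric_space measure \<Rightarrow> bool" where
  "doubling_measure M \<longleftrightarrow>
     (\<exists>A1\<ge>1. \<forall>x. \<forall>r>0. measure M (ball x (2 * r)) \<le> A1 * measure M (ball x r))"

definition RD_space :: "'a::metric_space measure \<Rightarrow> bool" where
  "RD_space M \<longleftrightarrow>
     regular_borel_measure M \<and>
     (\<forall>x. \<forall>r>0. 0 < emeasure M (ball x r) \<and> emeasure M (ball x r) < \<infinity>) \<and>
     doubling_measure M \<and>
     (\<exists>\<kappa> n A2 A3 :: real. 0 < \<kappa> \<and> \<kappa> \<le> n \<and> 0 < A2 \<and> A2 \<le> 1 \<and> 1 \<le> A3 \<and>
       (\<forall>x r t. 0 < r \<and> ennreal r \<le> ediam (UNIV :: 'a set) / 2 \<and>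
                1 \<le> t \<and> ennreal t \<le> ediam (UNIV :: 'a set) / ennreal (2 * r) \<longrightarrow>
          A2 * t powr \<kappa> * measure M (ball x r) \<le> measure M (ball x (t * r)) \<and>
          measure M (ball x (t * r)) \<le> A3 * t powr n * measure M (ball x r)))"

definition admissible :: "('a::metric_space \<Rightarrow> real) \<Rightarrow> bool" where
  "admissible \<rho> \<longleftrightarrow> (\<forall>x. 0 < \<rho> x) \<and>
     (\<exists>C0>0. \<exists>k0>0. \<forall>x y. 1 / \<rho> x \<le> C0 * (1 / \<rho> y) * (1 + dist x y / \<rho> y) powr k0)"

text \<open>Balls are represented by their center and radius, since the same set may be a ball
  for several such pairs, some of them in the collection \<open>\<D>\<close> and some not.\<close>

definition balls :: "('a::metric_space \<times> real) set" where
  "balls = {(x, r). 0 < r}"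

definition coll_D :: "('a::metric_space \<Rightarrow> real) \<Rightarrow> ('a \<times> real) set" where
  "coll_D \<rho> = {(x, r) \<in> balls. \<rho> x \<le> r}"

definition L1_loc :: "'a::metric_space measure \<Rightarrow> ('a \<Rightarrow> real) set" where
  "L1_loc M = {f. \<forall>(x, r)\<in>balls. set_integrable M (ball x r) f}"

definition avg :: "'a measure \<Rightarrow> ('a \<Rightarrow> real) \<Rightarrow> 'a set \<Rightarrow> real" where
  "avg M f B = (1 / measure M B) * (LINT y:B|M. f y)"

definition nn_avg :: "'a measure \<Rightarrow> ('a \<Rightarrow> ennreal) \<Rightarrow> 'a set \<Rightarrow> ennreal" where
  "nn_avg M g B = (\<integral>\<^sup>+y\<in>B. g y \<partial>M) / emeasure M B"

definition ess_inf :: "'a measure \<Rightarrow> 'a set \<Rightarrow> ('a \<Rightarrow> real) \<Rightarrow> ereal" where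
  "ess_inf M B f = Sup {c. AE y in M. y \<in> B \<longrightarrow> c \<le> ereal (f y)}"

definition BMO_norm :: "'a::metric_space measure \<Rightarrow> ('a \<Rightarrow> real) \<Rightarrow> ('a \<Rightarrow> real) \<Rightarrow> ennreal" where
  "BMO_norm M \<rho> f =
     (SUP (x, r)\<in>balls - coll_D \<rho>.
        nn_avg M (\<lambda>y. ennreal \<bar>f y - avg M f (ball x r)\<bar>) (ball x r)) +
     (SUP (x, r)\<in>coll_D \<rho>. nn_avg M (\<lambda>y. ennreal \<bar>f y\<bar>) (ball x r))"

text \<open>The essential infimum may be \<open>-\<infinity>\<close>; the corresponding average is then \<open>\<infinity>\<close>.\<close>

definition BLO_norm :: "'a::metric_space measure \<Rightarrow> ('a \<Rightarrow> real) \<Rightarrow> ('a \<Rightarrow> real) \<Rightarrow> ennreal" where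
  "BLO_norm M \<rho> f =
     (SUP (x, r)\<in>balls - coll_D \<rho>.
        nn_avg M (\<lambda>y. e2ennreal (ereal (f y) - ess_inf M (ball x r) f)) (ball x r)) +
     (SUP (x, r)\<in>coll_D \<rho>. nn_avg M (\<lambda>y. ennreal \<bar>f y\<bar>) (ball x r))"

definition BMO :: "'a::metric_space measure \<Rightarrow> ('a \<Rightarrow> real) \<Rightarrow> ('a \<Rightarrow> real) set" where
  "BMO M \<rho> = {f \<in> L1_loc M. BMO_norm M \<rho> f < \<infinity>}"

definition BLO :: "'a::metric_space measure \<Rightarrow> ('a \<Rightarrow> real) \<Rightarrow> ('a \<Rightarrow> real) set" where
  "BLO M \<rho> = {f \<in> L1_loc M. BLO_norm M \<rho> f < \<infinity>}"

definition maximal_fun ::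
    "'a::metric_space measure \<Rightarrow> ('a \<Rightarrow> real) \<Rightarrow> ('a \<Rightarrow> real) \<Rightarrow> 'a \<Rightarrow> ereal" where
  "maximal_fun M \<rho> f x =
     (SUP (z, r)\<in>{(z, r) \<in> balls - coll_D \<rho>. x \<in> ball z r}. ereal (avg M f (ball z r)))"

end

theory Submission
  imports Defs
begin

text \<open>Why the theorem holds. With \<open>b\<close> the \<open>BMO\<^sub>\<rho>\<close> norm of \<open>f\<close>, the mean oscillation of \<open>f\<close> over
  every ball, in \<open>\<D>\<close> or not, is at most \<open>2 b\<close>, because on a ball in \<open>\<D>\<close> it is at most twice the
  average of \<open>|f|\<close>. So \<open>f\<close> has bounded mean oscillation in the usual sense, with a constant \<open>N\<close>, and
  averages over balls of comparable size and position differ by a multiple of \<open>N\<close>.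

  The analytic input is a John--Nirenberg inequality for a local maximal function. For a ball
  \<open>B\<close> of radius \<open>R\<close> let \<open>m\<^sub>B(x)\<close> be the supremum of the averages of \<open>|f - f\<^sub>B|\<close> over the balls of radius
  at most \<open>R\<close> that contain \<open>x\<close>. A Vitali selection of nearly largest balls on which this average
  exceeds \<open>t\<close> covers the level set \<open>{m\<^sub>B > t}\<close> by balls \<open>8B\<^sub>j\<close> of total measure at most half
  of \<open>\<mu>(B)\<close>, once \<open>t\<close> is a large multiple of \<open>N\<close>; since \<open>f\<close> has on \<open>8B\<^sub>j\<close> an average within \<open>t\<close>
  of \<open>f\<^sub>B\<close>, the points of \<open>{m\<^sub>B > t + s}\<close> that the selection assigns to \<open>8B\<^sub>j\<close> lie in \<open>{m\<^bsub>8B\<^sub>j\<^esub> > s}\<close> (\<open>level_decay\<close>).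
  Iteration gives exponential decay, hence \<open>\<integral>\<^sub>B m\<^sub>B \<le> C N \<mu>(B)\<close> (\<open>integral_local_max\<close>).

  It remains to dominate the maximal function pointwise by \<open>m\<close>. Let \<open>B\<close> be in \<open>\<D>\<close>. By admissibility
  all balls outside \<open>\<D>\<close> that meet \<open>B\<close> have radius at most a fixed multiple of that of \<open>B\<close>;
  with \<open>B'\<close> that multiple of \<open>B\<close>, which is again in \<open>\<D>\<close>, the maximal function is on \<open>B\<close> at most
  \<open>|f\<^bsub>B'\<^esub>| + m\<^bsub>B'\<^esub>\<close> (\<open>maximal_fun_upper_large\<close>). Let \<open>B\<close> be outside \<open>\<D>\<close> and \<open>x\<close>, \<open>y\<close> in \<open>B\<close>. A ball
  through \<open>x\<close> smaller than \<open>B\<close> contributes at most \<open>f\<^sub>B + m\<^sub>B(x)\<close>, and \<open>f\<^sub>B\<close> is at most the maximal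
  function at \<open>y\<close>; a larger one either stays outside \<open>\<D>\<close> when it is enlarged to contain \<open>y\<close>, which
  costs a multiple of \<open>N\<close>, or has itself, like its enlargement, an average bounded by a multiple
  of \<open>N\<close> (\<open>maximal_fun_upper_small\<close>). From below the maximal
  function is bounded by a negative multiple of \<open>N\<close>, because every point is the centre of a ball
  outside \<open>\<D>\<close> whose double is in \<open>\<D>\<close> (\<open>maximal_fun_lower\<close>). So the maximal function at \<open>x\<close>
  exceeds its infimum over \<open>B\<close> by at most \<open>m\<^sub>B(x)\<close> plus a multiple of \<open>N\<close>.\<close>

section \<open>A Vitali covering lemma in metric spaces\<close>

text \<open>Zorn's lemma is applied to the disjoint subfamilies \<open>J\<close> with the following property: every
  ball of the family that meets a member of \<open>J\<close> meets one of at least half its own radius. The union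
  of a chain of such \<open>J\<close> is again one. A maximal \<open>J\<close> meets every ball: among the missed balls, one
  whose radius exceeds half of the supremum could be added.\<close>

lemma Vitali_covering_metric:
  fixes c :: "'i \<Rightarrow> 'a::metric_space" and r :: "'i \<Rightarrow> real"
  assumes r: "\<And>i. i \<in> I \<Longrightarrow> 0 < r i \<and> r i \<le> R"
  obtains J where "J \<subseteq> I" "disjoint_family_on (\<lambda>j. ball (c j) (r j)) J"
    "\<And>i. i \<in> I \<Longrightarrow> \<exists>j\<in>J. ball (c i) (r i) \<inter> ball (c j) (r j) \<noteq> {} \<and> r i \<le> 2 * r j"
proof -
  define B where "B i = ball (c i) (r i)" for i
  have B_ne: "B i \<inter> B i \<noteq> {}" if "i \<in> I" for i
    using r[OF that] by (auto simp: B_def)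
  define \<Omega> where "\<Omega> = {J. J \<subseteq> I \<and> disjoint_family_on B J \<and>
     (\<forall>i\<in>I. (\<exists>j\<in>J. B i \<inter> B j \<noteq> {}) \<longrightarrow> (\<exists>j\<in>J. B i \<inter> B j \<noteq> {} \<and> r i \<le> 2 * r j))}"
  \<comment> \<open>Zorn's lemma: the domination property passes to unions of chains.\<close>
  have "\<exists>J\<in>\<Omega>. \<forall>X\<in>\<Omega>. J \<subseteq> X \<longrightarrow> X = J"
  proof (rule subset_Zorn_nonempty)
    have "{} \<in> \<Omega>"
      by (auto simp: \<Omega>_def disjoint_family_on_def)
    then show "\<Omega> \<noteq> {}" by blast
  next
    fix \<C> assume ne: "\<C> \<noteq> {}" and ch: "subset.chain \<Omega> \<C>"
    have sub: "\<C> \<subseteq> \<Omega>" and lin: "X \<subseteq> Y \<or> Y \<subseteq> X" if "X \<in> \<C>" "Y \<in> \<C>" for X Y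
      using ch that by (auto simp: subset_chain_def)
    have "disjoint_family_on B (\<Union>\<C>)"
      unfolding disjoint_family_on_def
    proof (intro ballI impI)
      fix m n assume "m \<in> \<Union>\<C>" "n \<in> \<Union>\<C>" "m \<noteq> n"
      then obtain X where "X \<in> \<C>" "m \<in> X" "n \<in> X"
        using lin by blast
      then show "B m \<inter> B n = {}"
        using ch \<open>m \<noteq> n\<close> by (auto simp: \<Omega>_def disjoint_family_on_def subset_chain_def)
    qed
    moreover have "\<Union>\<C> \<subseteq> I"
      using ch by (auto simp: \<Omega>_def subset_chain_def)
    moreover have "\<exists>j\<in>\<Union>\<C>. B i \<inter> B j \<noteq> {} \<and> r i \<le> 2 * r j"
      if i: "i \<in> I" "\<exists>j\<in>\<Union>\<C>. B i \<inter> B j \<noteq> {}" for i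
    proof -
      obtain X where X: "X \<in> \<C>" "\<exists>j\<in>X. B i \<inter> B j \<noteq> {}"
        using i by blast
      then have "X \<in> \<Omega>" using ch by (auto simp: subset_chain_def)
      then have "\<exists>j\<in>X. B i \<inter> B j \<noteq> {} \<and> r i \<le> 2 * r j"
        using X i unfolding \<Omega>_def by blast
      then show ?thesis using X by blast
    qed
    ultimately show "\<Union>\<C> \<in> \<Omega>"
      unfolding \<Omega>_def by blast
  qed
  then obtain J where J: "J \<in> \<Omega>" and J_max: "\<And>X. X \<in> \<Omega> \<Longrightarrow> J \<subseteq> X \<Longrightarrow> X = J"
    by blast
  have meets: "\<exists>j\<in>J. B i \<inter> B j \<noteq> {}" if "i \<in> I" for i
  proof (rule ccontr)
    assume no: "\<not> ?thesis"
    define K where "K = {i \<in> I. \<forall>j\<in>J. B i \<inter> B j = {}}"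
    have K: "K \<noteq> {}" "K \<subseteq> I"
      using that no by (auto simp: K_def)
    have bdd: "bdd_above (r ` K)"
      using r K by (auto intro!: bdd_aboveI[of _ R])
    have "i \<in> K" using that no by (auto simp: K_def)
    then have "0 < Sup (r ` K)"
      using cSUP_upper[OF _ bdd] r[OF that] by force
    then have "Sup (r ` K) / 2 < Sup (r ` K)" by simp
    then obtain k where k: "k \<in> K" "Sup (r ` K) / 2 < r k"
      using less_cSUP_iff[OF K(1) bdd] by blast
    have "insert k J \<in> \<Omega>"
    proof -
      have "disjoint_family_on B (insert k J)"
        using J k(1) by (auto simp: \<Omega>_def K_def disjoint_family_on_def)
      moreover have "\<exists>j\<in>insert k J. B i \<inter> B j \<noteq> {} \<and> r i \<le> 2 * r j"
        if i: "i \<in> I" "\<exists>j\<in>insert k J. B i \<inter> B j \<noteq> {}" for i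
      proof (cases "i \<in> K")
        case True
        then have "r i \<le> 2 * r k"
          using cSUP_upper[OF True bdd] k by linarith
        moreover have "B i \<inter> B k \<noteq> {}"
          using i True unfolding K_def by blast
        ultimately show ?thesis by blast
      next
        case False
        then show ?thesis
          using J i unfolding \<Omega>_def K_def by blast
      qed
      ultimately show ?thesis
        using J k K unfolding \<Omega>_def by blast
    qed
    then have "k \<in> J" using J_max by blast
    then show False
      using k K B_ne unfolding K_def by blast
  qed
  show ?thesis
  proof (rule that)
    show "J \<subseteq> I" "disjoint_family_on (\<lambda>j. ball (c j) (r j)) J"
      using J by (auto simp: \<Omega>_def B_def[abs_def])
    show "\<exists>j\<in>J. ball (c i) (r i) \<inter> ball (c j) (r j) \<noteq> {} \<and> r i \<le> 2 * r j" if "i \<in> I" for i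
      using J meets[OF that] that unfolding \<Omega>_def B_def by blast
  qed
qed

text \<open>Disjointness only gives control of finite subfamilies; this carries the bound over to the
  whole selected family.\<close>

lemma emeasure_UN_le_of_finite:
  assumes J: "countable J" and G: "\<And>j. j \<in> J \<Longrightarrow> G j \<in> sets M"
    and le: "\<And>F. finite F \<Longrightarrow> F \<subseteq> J \<Longrightarrow> emeasure M (\<Union>j\<in>F. G j) \<le> K"
  shows "emeasure M (\<Union>j\<in>J. G j) \<le> K"
proof (cases "J = {}")
  case True
  then show ?thesis using le[of "{}"] by simp
next
  case False
  define e where "e = from_nat_into J"
  have e: "range e = J"
    using J False by (simp add: e_def)
  define U where "U n = (\<Union>j\<in>e ` {..n}. G j)" for n :: nat
  have "(\<Union>j\<in>J. G j) = (\<Union>n. U n)"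
    unfolding U_def e[symmetric] by blast
  moreover have "(SUP n. emeasure M (U n)) = emeasure M (\<Union>n. U n)"
  proof (rule SUP_emeasure_incseq)
    show "range U \<subseteq> sets M"
      using G e by (auto simp: U_def)
    show "incseq U"
      by (force simp: U_def incseq_def)
  qed
  moreover have "emeasure M (U n) \<le> K" for n
    unfolding U_def using e by (intro le) auto
  ultimately show ?thesis
    by (metis SUP_least)
qed

section \<open>Averages over balls of a doubling measure\<close>

locale doubling_space =
  fixes M :: "'a::metric_space measure" and A :: real
  assumes sets_M: "sets M = sets borel"
    and ball_pos: "\<And>x r. 0 < r \<Longrightarrow> 0 < emeasure M (ball x r)"
    and ball_fin: "\<And>x r. 0 < r \<Longrightarrow> emeasure M (ball x r) < \<infinity>"
    and A_ge_1: "1 \<le> A"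
    and doubling: "\<And>x r. 0 < r \<Longrightarrow> measure M (ball x (2 * r)) \<le> A * measure M (ball x r)"
begin

lemma A_pos: "0 < A" and A_nonneg: "0 \<le> A"
  using A_ge_1 by auto

lemma space_M: "space M = UNIV"
  using sets_eq_imp_space_eq[OF sets_M] by simp

lemma open_sets: "open S \<Longrightarrow> S \<in> sets M"
  by (simp add: sets_M)

lemma ball_sets [measurable, simp]: "ball x r \<in> sets M"
  by (simp add: open_sets)

lemma ball_fmeasurable: "ball x r \<in> fmeasurable M"
proof (cases "0 < r")
  case True
  then show ?thesis using ball_fin[OF True, of x] by (intro fmeasurableI) auto
next
  case False
  then show ?thesis by (simp add: ball_empty)
qed

lemma emeasure_ball: "emeasure M (ball x r) = ennreal (measure M (ball x r))"
  using fmeasurableD2[OF ball_fmeasurable] by (simp add: emeasure_eq_ennreal_measure)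

lemma measure_ball_pos: "0 < r \<Longrightarrow> 0 < measure M (ball x r)"
  using ball_pos[of r x] by (simp add: emeasure_ball)

lemma measure_ball_mono: "ball x r \<subseteq> ball y s \<Longrightarrow> measure M (ball x r) \<le> measure M (ball y s)"
  by (rule measure_mono_fmeasurable[OF _ _ ball_fmeasurable]) auto

lemma doubling_iterate:
  "0 < r \<Longrightarrow> measure M (ball x (2 ^ k * r)) \<le> A ^ k * measure M (ball x r)"
proof (induction k)
  case (Suc k)
  have "measure M (ball x (2 ^ Suc k * r)) = measure M (ball x (2 * (2 ^ k * r)))"
    by (simp add: mult.assoc)
  also have "\<dots> \<le> A * measure M (ball x (2 ^ k * r))"
    using Suc by (intro doubling) auto
  also have "\<dots> \<le> A * (A ^ k * measure M (ball x r))"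
    using Suc A_pos by (intro mult_left_mono) auto
  finally show ?case by (simp add: mult.assoc)
qed simp

lemma L1_locD: "f \<in> L1_loc M \<Longrightarrow> set_integrable M (ball x r) f"
  by (cases "0 < r") (auto simp: L1_loc_def balls_def ball_empty)

lemma L1_loc_diff_const [simp]:
  assumes "f \<in> L1_loc M" shows "(\<lambda>y. f y - c) \<in> L1_loc M"
proof -
  have "set_integrable M (ball x r) (\<lambda>y. c)" for x r
    using fmeasurableD2[OF ball_fmeasurable, of x r]
    by (auto simp: set_integrable_def less_top intro!: integrable_mult_left integrable_real_indicator)
  then show ?thesis
    using L1_locD[OF assms] by (auto simp: L1_loc_def intro!: set_integral_diff)
qed

lemma L1_loc_abs [simp]: "f \<in> L1_loc M \<Longrightarrow> (\<lambda>y. \<bar>f y\<bar>) \<in> L1_loc M"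
  by (auto simp: L1_loc_def intro: set_integrable_abs)

lemma avg_mult: "0 < r \<Longrightarrow> measure M (ball x r) * avg M g (ball x r) = (LINT y:ball x r|M. g y)"
  using measure_ball_pos[of r x] by (simp add: avg_def)

lemma avg_diff_const:
  assumes "f \<in> L1_loc M" "0 < r"
  shows "avg M (\<lambda>y. f y - c) (ball x r) = avg M f (ball x r) - c"
proof -
  have c: "set_integrable M (ball x r) (\<lambda>y. c)"
    using fmeasurableD2[OF ball_fmeasurable, of x r]
    by (auto simp: set_integrable_def less_top intro!: integrable_mult_left integrable_real_indicator)
  have "(LINT y:ball x r|M. f y - c) = (LINT y:ball x r|M. f y) - measure M (ball x r) * c"
    using c L1_locD[OF assms(1)] fmeasurableD2[OF ball_fmeasurable, of x r]
    by (subst set_integral_diff) (auto simp: set_integral_const)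
  then show ?thesis
    using measure_ball_pos[OF assms(2), of x] by (simp add: avg_def field_simps)
qed

lemma avg_mono:
  assumes "f \<in> L1_loc M" "g \<in> L1_loc M" "\<And>y. y \<in> ball x r \<Longrightarrow> f y \<le> g y"
  shows "avg M f (ball x r) \<le> avg M g (ball x r)"
  unfolding avg_def using L1_locD[OF assms(1)] L1_locD[OF assms(2)] assms(3)
  by (intro mult_left_mono set_integral_mono) auto

lemma abs_avg_le:
  assumes "f \<in> L1_loc M"
  shows "\<bar>avg M f (ball x r)\<bar> \<le> avg M (\<lambda>y. \<bar>f y\<bar>) (ball x r)"
proof -
  have "\<bar>LINT y:ball x r|M. f y\<bar> \<le> (LINT y:ball x r|M. \<bar>f y\<bar>)"
    unfolding set_lebesgue_integral_def
    by (rule order_trans[OF integral_abs_bound]) (simp add: abs_mult)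
  then show ?thesis
    by (simp add: avg_def abs_mult divide_right_mono)
qed

lemma abs_avg_diff_le:
  assumes "f \<in> L1_loc M" "0 < r"
  shows "\<bar>avg M f (ball x r) - c\<bar> \<le> avg M (\<lambda>y. \<bar>f y - c\<bar>) (ball x r)"
  using abs_avg_le[of "\<lambda>y. f y - c" x r] assms by (simp add: avg_diff_const)

lemma avg_abs_change_const:
  assumes "f \<in> L1_loc M" "0 < r"
  shows "avg M (\<lambda>y. \<bar>f y - c\<bar>) (ball x r) \<le> avg M (\<lambda>y. \<bar>f y - d\<bar>) (ball x r) + \<bar>d - c\<bar>"
proof -
  have "avg M (\<lambda>y. \<bar>f y - c\<bar> - \<bar>d - c\<bar>) (ball x r) \<le> avg M (\<lambda>y. \<bar>f y - d\<bar>) (ball x r)"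
    using assms by (intro avg_mono) auto
  then show ?thesis
    using assms by (simp add: avg_diff_const)
qed

lemma set_integral_mono_set:
  assumes "g \<in> L1_loc M" "\<And>y. 0 \<le> g y" "S \<in> sets M" "S \<subseteq> ball x r"
  shows "(LINT y:S|M. g y) \<le> (LINT y:ball x r|M. g y)"
  unfolding set_lebesgue_integral_def
  using L1_locD[OF assms(1), of x r] set_integrable_subset[OF L1_locD[OF assms(1), of x r] assms(3,4)] assms
  by (intro integral_mono) (auto simp: set_integrable_def split: split_indicator)

text \<open>The workhorse for comparing averages: a ball that fills a fixed proportion of a larger one
  has averages of nonnegative functions controlled by those of the larger.\<close>

lemma avg_subset_le:
  assumes "g \<in> L1_loc M" "\<And>y. 0 \<le> g y" "0 < r" "0 < s" "ball x r \<subseteq> ball w s"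
    and "measure M (ball w s) \<le> K * measure M (ball x r)"
  shows "avg M g (ball x r) \<le> K * avg M g (ball w s)"
proof -
  have nn: "0 \<le> avg M g (ball w s)"
    using assms(2) by (auto simp: avg_def set_lebesgue_integral_def intro!: mult_nonneg_nonneg integral_nonneg)
  have "measure M (ball x r) * avg M g (ball x r) \<le> measure M (ball w s) * avg M g (ball w s)"
    using assms by (simp add: avg_mult set_integral_mono_set)
  also have "\<dots> \<le> (K * measure M (ball x r)) * avg M g (ball w s)"
    using assms nn by (intro mult_right_mono)
  finally show ?thesis
    using measure_ball_pos[OF assms(3), of x] by (simp add: field_simps)
qed

lemma nn_avg_eq_avg:
  assumes "g \<in> L1_loc M" "\<And>y. 0 \<le> g y" "0 < r"
  shows "nn_avg M (\<lambda>y. ennreal (g y)) (ball x r) = ennreal (avg M g (ball x r))"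
proof -
  have "(\<integral>\<^sup>+y\<in>ball x r. ennreal (g y) \<partial>M) = (\<integral>\<^sup>+y. ennreal (indicator (ball x r) y *\<^sub>R g y) \<partial>M)"
    by (intro nn_integral_cong) (auto split: split_indicator)
  also have "\<dots> = ennreal (LINT y:ball x r|M. g y)"
    using L1_locD[OF assms(1), of x r] assms(2) unfolding set_lebesgue_integral_def set_integrable_def
    by (intro nn_integral_eq_integral) auto
  finally have "(\<integral>\<^sup>+y\<in>ball x r. ennreal (g y) \<partial>M) = ennreal (LINT y:ball x r|M. g y)" .
  moreover have "0 \<le> (LINT y:ball x r|M. g y)"
    using assms(2) by (auto simp: set_lebesgue_integral_def intro!: integral_nonneg)
  ultimately show ?thesis
    using measure_ball_pos[OF assms(3), of x]
    by (simp add: nn_avg_def avg_def emeasure_ball divide_ennreal)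
qed

text \<open>The measures of the balls have bounded finite partial sums and none of them vanishes.\<close>

lemma countable_disjoint_balls:
  fixes c :: "'i \<Rightarrow> 'a"
  assumes dis: "disjoint_family_on (\<lambda>j. ball (c j) (r j)) J"
    and r: "\<And>j. j \<in> J \<Longrightarrow> 0 < r j" and sub: "\<And>j. j \<in> J \<Longrightarrow> ball (c j) (r j) \<subseteq> ball z R"
  shows "countable J"
proof -
  let ?m = "\<lambda>j. measure M (ball (c j) (r j))"
  have "?m summable_on J"
  proof (rule nonneg_bounded_partial_sums_imp_summable_on)
    show "0 \<le> ?m x" for x by simp
    have "sum ?m F \<le> measure M (ball z R)" if "finite F" "F \<subseteq> J" for F
    proof -
      have "sum ?m F = measure M (\<Union>j\<in>F. ball (c j) (r j))"
        using that disjoint_family_on_mono[OF that(2) dis]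
        by (intro measure_finite_Union[symmetric]) (auto simp: emeasure_ball)
      also have "\<dots> \<le> measure M (ball z R)"
        using sub that by (intro measure_mono_fmeasurable[OF _ _ ball_fmeasurable]) auto
      finally show ?thesis .
    qed
    then show "\<forall>\<^sub>F F in finite_subsets_at_top J. sum ?m F \<le> measure M (ball z R)"
      by (intro eventually_finite_subsets_at_top_weakI) auto
  qed
  then have "countable {j \<in> J. ?m j \<noteq> 0}"
    by (rule summable_countable_real)
  moreover have "{j \<in> J. ?m j \<noteq> 0} = J"
    using r measure_ball_pos[THEN less_imp_neq] by fastforce
  ultimately show ?thesis by simp
qed

end

section \<open>Functions of bounded mean oscillation\<close>

text \<open>The bound \<open>N\<close> is a strictly positive upper bound and not the norm itself: the level sets below
  are taken at multiples of \<open>N\<close>, which must be positive also when \<open>f\<close> has norm zero.\<close>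

locale bounded_oscillation = doubling_space M A
  for M :: "'a::metric_space measure" and A :: real +
  fixes f :: "'a \<Rightarrow> real" and N :: real
  assumes f_loc: "f \<in> L1_loc M"
    and N_pos: "0 < N"
    and osc: "\<And>x r. 0 < r \<Longrightarrow> avg M (\<lambda>y. \<bar>f y - avg M f (ball x r)\<bar>) (ball x r) \<le> N"
begin

lemma avg_compare:
  assumes "0 < r" "0 < s" "ball x r \<subseteq> ball w s" "measure M (ball w s) \<le> K * measure M (ball x r)"
    and "0 \<le> K"
  shows "\<bar>avg M f (ball x r) - avg M f (ball w s)\<bar> \<le> K * N"
proof -
  have "\<bar>avg M f (ball x r) - avg M f (ball w s)\<bar>
      \<le> avg M (\<lambda>y. \<bar>f y - avg M f (ball w s)\<bar>) (ball x r)"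
    using f_loc assms by (intro abs_avg_diff_le)
  also have "\<dots> \<le> K * avg M (\<lambda>y. \<bar>f y - avg M f (ball w s)\<bar>) (ball w s)"
    using f_loc assms by (intro avg_subset_le) auto
  also have "\<dots> \<le> K * N"
    using osc assms by (intro mult_left_mono) auto
  finally show ?thesis .
qed

lemma avg_compare_power:
  assumes "0 < r" "0 < s" "ball x r \<subseteq> ball w s" "ball w s \<subseteq> ball x (2 ^ k * r)"
  shows "\<bar>avg M f (ball x r) - avg M f (ball w s)\<bar> \<le> A ^ k * N"
  using assms doubling_iterate[of r x k] measure_ball_mono[OF assms(4)] A_pos
  by (intro avg_compare) auto

text \<open>The reference constant is the average over \<open>ball z R\<close>, but the averaging balls, of
  radius at most \<open>R\<close>, need not lie in that ball. The cap on the radius is what makes the Vitali selection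
  possible.\<close>

definition local_max :: "'a \<Rightarrow> real \<Rightarrow> 'a \<Rightarrow> ennreal" where
  "local_max z R x = (SUP (w, r)\<in>{(w, r). 0 < r \<and> r \<le> R \<and> x \<in> ball w r}.
     ennreal (avg M (\<lambda>y. \<bar>f y - avg M f (ball z R)\<bar>) (ball w r)))"

definition level :: "'a \<Rightarrow> real \<Rightarrow> real \<Rightarrow> 'a set" where
  "level z R t = {x \<in> ball z R. ennreal t < local_max z R x}"

lemma level_iff:
  assumes "0 \<le> t"
  shows "x \<in> level z R t \<longleftrightarrow> x \<in> ball z R \<and>
    (\<exists>w r. 0 < r \<and> r \<le> R \<and> x \<in> ball w r \<and>
       t < avg M (\<lambda>y. \<bar>f y - avg M f (ball z R)\<bar>) (ball w r))"
  using assms by (auto simp: level_def local_max_def less_SUP_iff ennreal_less_iff)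

lemma open_local_max_greater: "open {x. a < local_max z R x}"
proof -
  have "{x. a < local_max z R x} = (\<Union>(w, r)\<in>{(w, r). 0 < r \<and> r \<le> R \<and>
      a < ennreal (avg M (\<lambda>y. \<bar>f y - avg M f (ball z R)\<bar>) (ball w r))}. ball w r)"
    unfolding local_max_def less_SUP_iff by fastforce
  then show ?thesis by auto
qed

lemma local_max_measurable [measurable]: "local_max z R \<in> borel_measurable M"
  by (rule borel_measurableI_greater) (auto simp: space_M intro!: open_sets open_local_max_greater)

lemma level_sets [measurable, simp]: "level z R t \<in> sets M"
proof -
  have "level z R t = ball z R \<inter> {x. ennreal t < local_max z R x}"
    by (auto simp: level_def)
  then show ?thesis
    by (auto intro!: open_sets open_Int open_local_max_greater)
qed

lemma level_subset: "level z R t \<subseteq> ball z R"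
  by (auto simp: level_def)

lemma avg_diff_le_local_max:
  assumes "0 < r" "r \<le> R" "x \<in> ball w r" "local_max z R x < \<infinity>"
  shows "\<bar>avg M f (ball w r) - avg M f (ball z R)\<bar> \<le> enn2real (local_max z R x)"
proof -
  have "ennreal \<bar>avg M f (ball w r) - avg M f (ball z R)\<bar>
     \<le> ennreal (avg M (\<lambda>y. \<bar>f y - avg M f (ball z R)\<bar>) (ball w r))"
    using f_loc assms by (intro ennreal_leI abs_avg_diff_le)
  also have "\<dots> \<le> local_max z R x"
    using assms unfolding local_max_def by (intro SUP_upper2[where i="(w, r)"]) auto
  also have "\<dots> = ennreal (enn2real (local_max z R x))"
    using assms(4) by simp
  finally show ?thesis by simp
qed

text \<open>The radii of the balls that witness membership of \<open>x\<close> are bounded by \<open>R\<close>; a witness with more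
  than half of the supremum will do. On balls through \<open>x\<close> whose radius is at least twice
  as large, but at most \<open>R\<close>, the average is then at most \<open>t\<close>.\<close>

lemma level_extremal_ball:
  assumes "x \<in> level z R t" "0 \<le> t"
  defines "P \<equiv> \<lambda>w r. 0 < r \<and> r \<le> R \<and> x \<in> ball w r \<and>
       t < avg M (\<lambda>y. \<bar>f y - avg M f (ball z R)\<bar>) (ball w r)"
  shows "\<exists>w r. P w r \<and> (\<forall>w' r'. P w' r' \<longrightarrow> r' < 2 * r)"
proof -
  define S where "S = {r. \<exists>w. P w r}"
  obtain w0 r0 where "P w0 r0"
    using assms(1,2) unfolding P_def by (auto simp: level_iff)
  then have r0: "r0 \<in> S" by (auto simp: S_def)
  have bdd: "bdd_above S"
    by (auto simp: S_def P_def intro!: bdd_aboveI[of _ R])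
  have "0 < Sup S"
    using cSup_upper[OF r0 bdd] \<open>P w0 r0\<close> by (simp add: P_def)
  then have "Sup S / 2 < Sup S" by simp
  then obtain r where r: "r \<in> S" "Sup S / 2 < r"
    using less_cSup_iff[OF _ bdd] r0 by blast
  have "r' < 2 * r" if "P w' r'" for w' r'
  proof -
    have "r' \<le> Sup S" using that by (intro cSup_upper bdd) (auto simp: S_def)
    then show ?thesis using r by simp
  qed
  then show ?thesis using r(1) unfolding S_def by blast
qed

text \<open>One step of the John--Nirenberg iteration. The Vitali balls \<open>B\<^sub>j\<close> of extremal witnesses have
  small total measure, by Chebyshev's inequality. A point of the level set at height \<open>t + s\<close> lies in
  some \<open>5B\<^sub>j\<close>, and extremality bounds the radius of its witness by \<open>4r\<^sub>j\<close>, so that the witness also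
  counts in the local maximal function of \<open>8B\<^sub>j\<close>; the factor 8 is the first power of two above 5.
  Exchanging the reference constant for the average over \<open>8B\<^sub>j\<close> costs at most \<open>t\<close>, which leaves
  height \<open>s\<close> relative to \<open>8B\<^sub>j\<close>. The threshold \<open>4 A\<^sup>7 N\<close> serves two purposes: it makes the total measure
  of the balls \<open>8B\<^sub>j\<close> at most half of that of the given ball, and it exceeds the difference of averages
  of \<open>f\<close> over comparable balls.\<close>

lemma level_decay:
  assumes R: "0 < R" and t: "4 * A ^ 7 * N \<le> t" and s: "0 \<le> s" and p: "0 \<le> p"
    and bound: "\<And>z' R'. 0 < R' \<Longrightarrow> emeasure M (level z' R' s) \<le> ennreal (p * measure M (ball z' R'))"
  shows "emeasure M (level z R (t + s)) \<le> ennreal (p / 2 * measure M (ball z R))"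
proof -
  let ?c = "avg M f (ball z R)"
  define g where "g y = \<bar>f y - ?c\<bar>" for y
  have g: "g \<in> L1_loc M" "\<And>y. 0 \<le> g y"
    using f_loc by (auto simp: g_def[abs_def])
  have pow: "A ^ i \<le> A ^ j" if "i \<le> j" for i j
    using A_ge_1 that by (rule power_increasing[rotated])
  have A0: "0 < A ^ i" for i using A_pos by simp
  have T0: "0 < 4 * A ^ 7 * N" using A_pos N_pos by simp
  then have t0: "0 < t" using t by (rule less_le_trans)
  have "\<forall>x\<in>level z R t. \<exists>w r. (0 < r \<and> r \<le> R \<and> x \<in> ball w r \<and> t < avg M g (ball w r)) \<and>
      (\<forall>w' r'. 0 < r' \<and> r' \<le> R \<and> x \<in> ball w' r' \<and> t < avg M g (ball w' r') \<longrightarrow> r' < 2 * r)"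
    using level_extremal_ball[of _ z R t] t0 unfolding g_def[abs_def] by simp
  then obtain w r where wr: "\<And>x. x \<in> level z R t \<Longrightarrow>
        0 < r x \<and> r x \<le> R \<and> x \<in> ball (w x) (r x) \<and> t < avg M g (ball (w x) (r x))"
    and ext: "\<And>x w' r'. x \<in> level z R t \<Longrightarrow> 0 < r' \<Longrightarrow> r' \<le> R \<Longrightarrow> x \<in> ball w' r' \<Longrightarrow>
         t < avg M g (ball w' r') \<Longrightarrow> r' < 2 * r x"
    by metis
  obtain J where J: "J \<subseteq> level z R t" "disjoint_family_on (\<lambda>j. ball (w j) (r j)) J"
    and cov: "\<And>i. i \<in> level z R t \<Longrightarrow>
        \<exists>j\<in>J. ball (w i) (r i) \<inter> ball (w j) (r j) \<noteq> {} \<and> r i \<le> 2 * r j"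
    by (rule Vitali_covering_metric[of "level z R t" r R w]) (use wr in auto)
  have j: "0 < r j" "r j \<le> R" "j \<in> ball (w j) (r j)" "t < avg M g (ball (w j) (r j))" "j \<in> ball z R"
      "dist z (w j) < R + r j" "j \<in> level z R t"
    if "j \<in> J" for j
  proof -
    have jl: "j \<in> level z R t" using that J(1) by blast
    then show *: "0 < r j" "r j \<le> R" "j \<in> ball (w j) (r j)" "t < avg M g (ball (w j) (r j))"
       "j \<in> ball z R" "j \<in> level z R t"
      using wr[OF jl] subsetD[OF level_subset jl] jl by auto
    show "dist z (w j) < R + r j"
      using dist_triangle2[of z "w j" j] *(3,5) by simp
  qed
  have sub4: "ball (w j) (r j) \<subseteq> ball z (4 * R)" if "j \<in> J" for j
  proof
    fix y assume "y \<in> ball (w j) (r j)"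
    then show "y \<in> ball z (4 * R)"
      using j[OF that] dist_triangle[of z y "w j"] by simp
  qed
  have countJ: "countable J"
    using J(2) j(1) sub4 by (rule countable_disjoint_balls)
  \<comment> \<open>Chebyshev on the disjoint balls, all inside \<open>ball z (4 * R)\<close>; the choice of the threshold
    for \<open>t\<close> makes the constant at most one half.\<close>
  have pack: "(\<Sum>j\<in>F. measure M (ball (w j) (8 * r j))) \<le> measure M (ball z R) / 2"
    if F: "finite F" "F \<subseteq> J" for F
  proof -
    let ?m = "\<Sum>j\<in>F. measure M (ball (w j) (r j))"
    have "t * ?m \<le> (\<Sum>j\<in>F. LINT y:ball (w j) (r j)|M. g y)"
      unfolding sum_distrib_left
    proof (rule sum_mono)
      fix i assume "i \<in> F"
      then have i: "i \<in> J" using F by blast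
      have "measure M (ball (w i) (r i)) * t \<le> measure M (ball (w i) (r i)) * avg M g (ball (w i) (r i))"
        using j(4)[OF i] by (intro mult_left_mono) auto
      then show "t * measure M (ball (w i) (r i)) \<le> (LINT y:ball (w i) (r i)|M. g y)"
        using j(1)[OF i] by (simp add: avg_mult mult.commute)
    qed
    also have "\<dots> = (LINT y:(\<Union>j\<in>F. ball (w j) (r j))|M. g y)"
      using F J(2) L1_locD[OF g(1)] 
      by (intro set_integral_finite_Union[symmetric]) (auto intro: disjoint_family_on_mono)
    also have "\<dots> \<le> (LINT y:ball z (4 * R)|M. g y)"
      using g F sub4 by (intro set_integral_mono_set) auto
    also have "\<dots> = measure M (ball z (4 * R)) * avg M g (ball z (4 * R))"
      using R by (simp add: avg_mult)
    also have "\<dots> \<le> (A ^ 2 * measure M (ball z R)) * (N + A ^ 2 * N)"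
    proof (rule mult_mono)
      show "measure M (ball z (4 * R)) \<le> A ^ 2 * measure M (ball z R)"
        using doubling_iterate[OF R, of z 2] by simp
      have "avg M g (ball z (4 * R)) \<le> avg M (\<lambda>y. \<bar>f y - avg M f (ball z (4 * R))\<bar>) (ball z (4 * R))
          + \<bar>avg M f (ball z (4 * R)) - ?c\<bar>"
        unfolding g_def[abs_def] using f_loc R by (intro avg_abs_change_const) auto
      also have "\<dots> \<le> N + A ^ 2 * N"
      proof (rule add_mono)
        show "\<bar>avg M f (ball z (4 * R)) - ?c\<bar> \<le> A ^ 2 * N"
          using avg_compare_power[of R "4 * R" z z 2] R subset_ball[of R "4 * R" z]
          by (simp add: abs_minus_commute)
      qed (use osc R in auto)
      finally show "avg M g (ball z (4 * R)) \<le> N + A ^ 2 * N" .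
    qed (use A_nonneg N_pos g(2) in \<open>auto simp: avg_def set_lebesgue_integral_def 
          intro!: mult_nonneg_nonneg integral_nonneg add_nonneg_nonneg\<close>)
    finally have 1: "t * ?m \<le> (A ^ 2 * measure M (ball z R)) * (N + A ^ 2 * N)" .
    have 2: "(\<Sum>j\<in>F. measure M (ball (w j) (8 * r j))) \<le> A ^ 3 * ?m"
      unfolding sum_distrib_left
      using doubling_iterate[OF j(1), of _ "w _" 3] F by (intro sum_mono) auto
    have "t * (\<Sum>j\<in>F. measure M (ball (w j) (8 * r j))) \<le> A ^ 3 * (t * ?m)"
      using mult_left_mono[OF 2, of t] t0 by (simp add: mult.left_commute)
    also have "\<dots> \<le> A ^ 3 * ((A ^ 2 * measure M (ball z R)) * (N + A ^ 2 * N))"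
      using 1 A_nonneg by (intro mult_left_mono) auto
    also have "\<dots> = (A ^ 5 + A ^ 7) * (N * measure M (ball z R))"
      by (simp add: algebra_simps eval_nat_numeral)
    also have "\<dots> \<le> (2 * A ^ 7) * (N * measure M (ball z R))"
      using pow[of 5 7] N_pos by (intro mult_right_mono) auto
    also have "\<dots> = (4 * A ^ 7 * N) * (measure M (ball z R) / 2)" by simp
    also have "\<dots> \<le> t * (measure M (ball z R) / 2)"
      using t by (intro mult_right_mono) auto
    finally show ?thesis using t0 by simp
  qed
  have cover: "level z R (t + s) \<subseteq> (\<Union>j\<in>J. level (w j) (8 * r j) s)"
  proof
    fix x assume "x \<in> level z R (t + s)"
    then obtain v q where x: "x \<in> ball z R" and q: "0 < q" "q \<le> R" "x \<in> ball v q"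
        "t + s < avg M g (ball v q)"
      using t0 s unfolding g_def[abs_def] by (auto simp: level_iff)
    have xt: "x \<in> level z R t"
      using x q t0 s unfolding level_iff[OF less_imp_le[OF t0]] g_def[abs_def, symmetric] by force
    obtain k where k: "k \<in> J" "ball (w x) (r x) \<inter> ball (w k) (r k) \<noteq> {}" "r x \<le> 2 * r k"
      using cov[OF xt] by blast
    note jk = j[OF k(1)]
    obtain y where y: "dist (w x) y < r x" "dist (w k) y < r k"
      using k(2) by auto
    have "dist (w k) x < 5 * r k"
      using dist_triangle[of "w k" x y] dist_triangle3[of y x "w x"] y wr[OF xt] k(3)
      by (simp add: dist_commute)
    then have xk: "x \<in> ball (w k) (8 * r k)"
      using jk(1) by simp
    have "q < 2 * r x"
      using ext[OF xt q(1,2,3)] q(4) s by simp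
    then have qk: "q \<le> 8 * r k" using k(3) jk(1) by simp
    \<comment> \<open>If \<open>8 * r k\<close> is within the cap, extremality of the selected ball bounds the average over the
      dilated ball by \<open>t\<close>. Otherwise that ball is comparable to \<open>ball z R\<close> and the oscillation bound
      applies, through a common ball \<open>?Q\<close>.\<close>
    have close: "\<bar>avg M f (ball (w k) (8 * r k)) - ?c\<bar> \<le> t"
    proof (cases "8 * r k \<le> R")
      case True
      have "\<not> t < avg M g (ball (w k) (8 * r k))"
      proof
        assume "t < avg M g (ball (w k) (8 * r k))"
        then have "8 * r k < 2 * r k"
          using True jk by (intro ext[of k _ "w k"]) auto
        then show False using jk by simp
      qed
      then show ?thesis
        using abs_avg_diff_le[OF f_loc, of "8 * r k" "w k" ?c] jk(1) unfolding g_def[abs_def] by simp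
    next
      case False
      let ?Q = "ball (w k) (32 * r k)"
      have "\<bar>avg M f (ball (w k) (8 * r k)) - avg M f ?Q\<bar> \<le> A ^ 2 * N"
        using jk(1) by (intro avg_compare_power) auto
      moreover have "\<bar>?c - avg M f ?Q\<bar> \<le> A ^ 6 * N"
      proof (rule avg_compare_power)
        show "ball z R \<subseteq> ?Q"
        proof
          fix u assume "u \<in> ball z R"
          then show "u \<in> ?Q"
            using False jk(2,6) dist_triangle3[of "w k" u z] by simp
        qed
        show "?Q \<subseteq> ball z (2 ^ 6 * R)"
        proof
          fix u assume "u \<in> ?Q"
          then show "u \<in> ball z (2 ^ 6 * R)"
            using R jk(2,6) dist_triangle[of z u "w k"] by simp
        qed
      qed (use R jk in auto)
      ultimately have "\<bar>avg M f (ball (w k) (8 * r k)) - ?c\<bar> \<le> A ^ 2 * N + A ^ 6 * N"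
        by linarith
      also have "\<dots> \<le> 4 * A ^ 7 * N"
      proof -
        have "(A ^ 2 + A ^ 6) * N \<le> (4 * A ^ 7) * N"
          using pow[of 2 7] pow[of 6 7] A0[of 7] N_pos by (intro mult_right_mono) linarith+
        then show ?thesis by (simp add: algebra_simps)
      qed
      finally show ?thesis using t by simp
    qed
    have "avg M g (ball v q) \<le> avg M (\<lambda>y. \<bar>f y - avg M f (ball (w k) (8 * r k))\<bar>) (ball v q)
         + \<bar>avg M f (ball (w k) (8 * r k)) - ?c\<bar>"
      unfolding g_def[abs_def] using f_loc q(1) by (intro avg_abs_change_const)
    then have "s < avg M (\<lambda>y. \<bar>f y - avg M f (ball (w k) (8 * r k))\<bar>) (ball v q)"
      using q(4) close by linarith
    then have "x \<in> level (w k) (8 * r k) s"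
      using s q qk xk by (auto simp: level_iff)
    then show "x \<in> (\<Union>j\<in>J. level (w j) (8 * r j) s)"
      using k(1) by blast
  qed
  have "emeasure M (level z R (t + s)) \<le> emeasure M (\<Union>j\<in>J. level (w j) (8 * r j) s)"
    using cover countJ by (intro emeasure_mono) auto
  also have "\<dots> \<le> ennreal (p / 2 * measure M (ball z R))"
  proof (rule emeasure_UN_le_of_finite[OF countJ])
    fix F assume F: "finite F" "F \<subseteq> J"
    have "emeasure M (\<Union>j\<in>F. level (w j) (8 * r j) s) \<le> (\<Sum>j\<in>F. emeasure M (level (w j) (8 * r j) s))"
      using F by (intro emeasure_subadditive_finite) auto
    also have "\<dots> \<le> (\<Sum>j\<in>F. ennreal (p * measure M (ball (w j) (8 * r j))))"
      using F j(1) by (intro sum_mono bound) auto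
    also have "\<dots> = ennreal (p * (\<Sum>j\<in>F. measure M (ball (w j) (8 * r j))))"
      using p by (simp add: sum_distrib_left sum_ennreal)
    also have "\<dots> \<le> ennreal (p / 2 * measure M (ball z R))"
      using mult_left_mono[OF pack[OF F] p] by (intro ennreal_leI) simp
    finally show "emeasure M (\<Union>j\<in>F. level (w j) (8 * r j) s) \<le> ennreal (p / 2 * measure M (ball z R))" .
  qed simp
  finally show ?thesis .
qed

lemma level_exponential_decay:
  "0 < R \<Longrightarrow> emeasure M (level z R (real k * (4 * A ^ 7 * N))) \<le> ennreal ((1 / 2) ^ k * measure M (ball z R))"
proof (induction k arbitrary: z R)
  case 0
  then show ?case
    using emeasure_mono[OF level_subset ball_sets] by (simp add: emeasure_ball)
next
  case (Suc k)
  have "emeasure M (level z R (4 * A ^ 7 * N + real k * (4 * A ^ 7 * N)))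
      \<le> ennreal ((1 / 2) ^ k / 2 * measure M (ball z R))"
    using Suc A_nonneg N_pos by (intro level_decay) auto
  then show ?case by (simp add: algebra_simps)
qed

text \<open>A layer-cake sum over the levels \<open>k T\<close>, whose measures decay geometrically.\<close>

lemma integral_local_max:
  assumes R: "0 < R"
  shows "(\<integral>\<^sup>+x\<in>ball z R. local_max z R x \<partial>M) \<le> ennreal (8 * A ^ 7 * N * measure M (ball z R))"
proof -
  define T where "T = 4 * A ^ 7 * N"
  have T: "0 < T" using A_pos N_pos by (simp add: T_def)
  have "local_max z R x * indicator (ball z R) x \<le> (\<Sum>k. ennreal T * indicator (level z R (real k * T)) x)"
    for x
  proof (cases "x \<in> ball z R")
    case True
    have "ennreal (avg M (\<lambda>y. \<bar>f y - avg M f (ball z R)\<bar>) (ball w r))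
        \<le> (\<Sum>k. ennreal T * indicator (level z R (real k * T)) x)"
      if r: "0 < r" "r \<le> R" "x \<in> ball w r" for w r
    proof -
      \<comment> \<open>A witness with average \<open>a\<close> puts \<open>x\<close> into the first \<open>\<lceil>a / T\<rceil>\<close> level sets.\<close>
      define a where "a = avg M (\<lambda>y. \<bar>f y - avg M f (ball z R)\<bar>) (ball w r)"
      define n where "n = nat \<lceil>a / T\<rceil>"
      have "a / T \<le> real n" unfolding n_def by linarith
      then have "a \<le> real n * T" using T by (simp add: field_simps)
      have "x \<in> level z R (real k * T)" if "k < n" for k
      proof -
        have "real k < a / T" using that unfolding n_def by linarith
        then have "real k * T < a" using T by (simp add: field_simps)
        then show ?thesis using T r True unfolding a_def by (auto simp: level_iff)
      qed
      then have "(\<Sum>k<n. ennreal T * indicator (level z R (real k * T)) x) = (\<Sum>k<n. ennreal T)"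
        by (intro sum.cong) auto
      also have "\<dots> = ennreal (real n * T)"
        using T by (simp add: ennreal_mult ennreal_of_nat_eq_real_of_nat)
      finally have "ennreal a \<le> (\<Sum>k<n. ennreal T * indicator (level z R (real k * T)) x)"
        using \<open>a \<le> real n * T\<close> by (simp add: ennreal_leI)
      also have "\<dots> \<le> (\<Sum>k. ennreal T * indicator (level z R (real k * T)) x)"
        by (intro sum_le_suminf) auto
      finally show ?thesis by (simp add: a_def)
    qed
    then show ?thesis
      using True unfolding local_max_def by (auto intro!: SUP_least)
  qed simp
  then have "(\<integral>\<^sup>+x\<in>ball z R. local_max z R x \<partial>M)
      \<le> (\<integral>\<^sup>+x. (\<Sum>k. ennreal T * indicator (level z R (real k * T)) x) \<partial>M)"
    by (intro nn_integral_mono) auto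
  also have "\<dots> = (\<Sum>k. ennreal T * emeasure M (level z R (real k * T)))"
    by (subst nn_integral_suminf) (auto simp: nn_integral_cmult_indicator)
  also have "\<dots> \<le> (\<Sum>k. ennreal (T * measure M (ball z R) * (1 / 2) ^ k))"
  proof (intro suminf_le)
    fix k
    have "ennreal T * emeasure M (level z R (real k * T)) 
        \<le> ennreal T * ennreal ((1 / 2) ^ k * measure M (ball z R))"
      unfolding T_def using level_exponential_decay[OF R] by (intro mult_left_mono) auto
    also have "\<dots> = ennreal (T * measure M (ball z R) * (1 / 2) ^ k)"
      using T by (simp add: ennreal_mult[symmetric] mult_ac)
    finally show "ennreal T * emeasure M (level z R (real k * T)) 
        \<le> ennreal (T * measure M (ball z R) * (1 / 2) ^ k)" .
  qed auto
  also have "\<dots> = ennreal (T * measure M (ball z R) * 2)"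
    using T geometric_sums[of "1/2::real"]
    by (intro suminf_ennreal_eq sums_mult) auto
  finally show ?thesis by (simp add: T_def mult_ac)
qed

text \<open>Both halves of the \<open>BLO\<^sub>\<rho>\<close> norm are estimated through this lemma: with \<open>k = 0\<close> on balls
  outside \<open>\<D>\<close>, and on balls in \<open>\<D>\<close> with the \<open>k\<close> that admissibility provides.\<close>

lemma nn_avg_le_of_local_max:
  assumes R: "0 < R" and c: "0 \<le> c"
    and g: "AE y in M. y \<in> ball z R \<longrightarrow> g y \<le> ennreal c + local_max z (2 ^ k * R) y"
  shows "nn_avg M g (ball z R) \<le> ennreal (c + 8 * A ^ (7 + k) * N)"
proof -
  let ?m = "measure M (ball z R)" and ?S = "2 ^ k * R"
  have sub: "ball z R \<subseteq> ball z ?S"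
    using R by (intro subset_ball) simp
  have "(\<integral>\<^sup>+y\<in>ball z R. g y \<partial>M)
      \<le> (\<integral>\<^sup>+y. ennreal c * indicator (ball z R) y + local_max z ?S y * indicator (ball z ?S) y \<partial>M)"
  proof (rule nn_integral_mono_AE)
    show "AE y in M. g y * indicator (ball z R) y
        \<le> ennreal c * indicator (ball z R) y + local_max z ?S y * indicator (ball z ?S) y"
      using g
    proof eventually_elim
      case (elim y)
      show ?case
      proof (cases "y \<in> ball z R")
        case True
        then have "y \<in> ball z ?S" using sub by blast
        then show ?thesis using True elim by simp
      qed simp
    qed
  qed
  also have "\<dots> = ennreal c * emeasure M (ball z R) + (\<integral>\<^sup>+y\<in>ball z ?S. local_max z ?S y \<partial>M)"
    by (subst nn_integral_add) (auto simp: nn_integral_cmult_indicator)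
  also have "\<dots> \<le> ennreal (c * ?m) + ennreal (8 * A ^ 7 * N * measure M (ball z ?S))"
    using R c by (intro add_mono integral_local_max) (auto simp: emeasure_ball ennreal_mult)
  also have "\<dots> \<le> ennreal (c * ?m) + ennreal (8 * A ^ 7 * N * (A ^ k * ?m))"
    using doubling_iterate[OF R, of z k] A_nonneg N_pos
    by (intro add_left_mono ennreal_leI mult_left_mono) auto
  also have "\<dots> = ennreal ((c + 8 * A ^ (7 + k) * N) * ?m)"
    using c A_nonneg N_pos by (subst ennreal_plus[symmetric]) (auto simp: algebra_simps power_add)
  finally have "nn_avg M g (ball z R) \<le> ennreal ((c + 8 * A ^ (7 + k) * N) * ?m) / ennreal ?m"
    unfolding nn_avg_def emeasure_ball by (intro divide_right_mono_ennreal)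
  also have "\<dots> = ennreal (c + 8 * A ^ (7 + k) * N)"
    using measure_ball_pos[OF R, of z] c A_nonneg N_pos by (subst divide_ennreal) auto
  finally show ?thesis .
qed

lemma AE_local_max_finite:
  assumes "0 < R" shows "AE x in M. x \<in> ball z R \<longrightarrow> local_max z R x < \<infinity>"
proof -
  have "(\<integral>\<^sup>+x\<in>ball z R. local_max z R x \<partial>M) \<noteq> \<infinity>"
    using integral_local_max[OF assms, of z] by (auto simp: top_unique)
  then have "AE x in M. local_max z R x * indicator (ball z R) x \<noteq> \<infinity>"
    by (intro nn_integral_noteq_infinite) auto
  then show ?thesis
    by eventually_elim (auto simp: less_top)
qed

end

section \<open>The maximal function with respect to an admissible function\<close>

text \<open>A ball outside \<open>\<D>\<close> that meets a ball in \<open>\<D>\<close> cannot be much larger. If \<open>dist x y < \<rho> y\<close>, admissibility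
  bounds \<open>\<rho> y\<close> by \<open>K * \<rho> x\<close>. This is used twice, from the centre \<open>w\<close> to the common point \<open>x\<close> and from
  \<open>x\<close> to the centre \<open>z\<close>, unless \<open>\<rho> x\<close> is already below \<open>r\<close>. A power of two is convenient
  for iterating the doubling condition.\<close>

lemma admissible_radius_bound:
  assumes "admissible \<rho>"
  obtains k :: nat where "\<And>z r x w q. \<rho> z \<le> r \<Longrightarrow> x \<in> ball z r \<Longrightarrow> x \<in> ball w q \<Longrightarrow> q < \<rho> w
      \<Longrightarrow> q \<le> 2 ^ k * r"
proof -
  have pos: "0 < \<rho> x" for x
    using assms by (auto simp: admissible_def)
  obtain C0 k0 where C0: "0 < C0" "0 < k0"
    and adm: "\<And>x y. 1 / \<rho> x \<le> C0 * (1 / \<rho> y) * (1 + dist x y / \<rho> y) powr k0"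
    using assms unfolding admissible_def by blast
  define K where "K = max 1 (C0 * 2 powr k0)"
  have K: "1 \<le> K" by (simp add: K_def)
  have near: "\<rho> y \<le> K * \<rho> x" if "dist x y < \<rho> y" for x y
  proof -
    have "(1 + dist x y / \<rho> y) powr k0 \<le> 2 powr k0"
      using that pos[of y] C0 by (intro powr_mono2) (auto simp: field_simps)
    then have "C0 * (1 / \<rho> y) * (1 + dist x y / \<rho> y) powr k0 \<le> C0 * (1 / \<rho> y) * 2 powr k0"
      using C0 pos[of y] by (intro mult_left_mono) auto
    with adm[of x y] have "1 / \<rho> x \<le> C0 * (1 / \<rho> y) * 2 powr k0" by linarith
    then have "\<rho> y \<le> C0 * 2 powr k0 * \<rho> x"
      using pos[of x] pos[of y] by (simp add: field_simps)
    also have "\<dots> \<le> K * \<rho> x"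
      using pos[of x] by (intro mult_right_mono) (auto simp: K_def)
    finally show ?thesis .
  qed
  obtain k :: nat where k: "K * K < 2 ^ k"
    using real_arch_pow[of 2 "K * K"] by auto
  show ?thesis
  proof (rule that)
    fix z r x w q
    assume zr: "\<rho> z \<le> r" "x \<in> ball z r" and wq: "x \<in> ball w q" "q < \<rho> w"
    have r: "0 < r" using pos[of z] zr by simp
    have "\<rho> x \<le> K * r"
    proof (cases "r \<le> \<rho> x")
      case True
      then have "\<rho> x \<le> K * \<rho> z" using zr by (intro near) auto
      also have "\<dots> \<le> K * r" using zr K by (intro mult_left_mono) auto
      finally show ?thesis .
    next
      case False
      then have "\<rho> x \<le> 1 * r" by simp
      also have "\<dots> \<le> K * r" using K r by (intro mult_right_mono) auto
      finally show ?thesis .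
    qed
    moreover have "\<rho> w \<le> K * \<rho> x"
      using wq by (intro near) (simp add: dist_commute)
    ultimately have "\<rho> w \<le> K * (K * r)"
      using K by (meson mult_left_mono order_trans zero_le_one)
    also have "\<dots> \<le> 2 ^ k * r"
      using k r by (simp add: mult.assoc[symmetric])
    finally show "q \<le> 2 ^ k * r" using wq by simp
  qed
qed

lemma less_maximal_fun_iff:
  "a < maximal_fun M \<rho> f x \<longleftrightarrow>
     (\<exists>z r. 0 < r \<and> r < \<rho> z \<and> x \<in> ball z r \<and> a < ereal (avg M f (ball z r)))"
proof -
  have "{(z, r) \<in> balls - coll_D \<rho>. x \<in> ball z r} = {(z, r). 0 < r \<and> r < \<rho> z \<and> x \<in> ball z r}"
    by (auto simp: coll_D_def balls_def)
  then show ?thesis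
    unfolding maximal_fun_def less_SUP_iff by (simp add: Bex_def)
qed

lemma avg_le_maximal_fun:
  assumes "0 < r" "r < \<rho> z" "x \<in> ball z r"
  shows "ereal (avg M f (ball z r)) \<le> maximal_fun M \<rho> f x"
  unfolding maximal_fun_def using assms
  by (intro SUP_upper2[where i="(z, r)"]) (auto simp: coll_D_def balls_def)

lemma maximal_fun_leI:
  assumes "\<And>z r. 0 < r \<Longrightarrow> r < \<rho> z \<Longrightarrow> x \<in> ball z r \<Longrightarrow> ereal (avg M f (ball z r)) \<le> b"
  shows "maximal_fun M \<rho> f x \<le> b"
  unfolding maximal_fun_def using assms by (intro SUP_least) (auto simp: coll_D_def balls_def)

text \<open>Admissibility of \<open>\<rho>\<close> enters through the comparison of radii, so that all constants depend
  on \<open>A\<close> and \<open>k\<close> alone.\<close>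

locale bmo_rho = bounded_oscillation M A f N
  for M :: "'a::metric_space measure" and A :: real and f :: "'a \<Rightarrow> real" and N :: real +
  fixes \<rho> :: "'a \<Rightarrow> real" and k :: nat
  assumes \<rho>_pos: "\<And>x. 0 < \<rho> x"
    and avg_large: "\<And>x r. \<rho> x \<le> r \<Longrightarrow> avg M (\<lambda>y. \<bar>f y\<bar>) (ball x r) \<le> N"
    and radius: "\<And>z r x w q. \<rho> z \<le> r \<Longrightarrow> x \<in> ball z r \<Longrightarrow> x \<in> ball w q \<Longrightarrow> q < \<rho> w
      \<Longrightarrow> q \<le> 2 ^ k * r"
begin

abbreviation "Mf \<equiv> maximal_fun M \<rho> f"

abbreviation "F \<equiv> \<lambda>x. real_of_ereal (Mf x)"

lemma abs_avg_large: "\<rho> x \<le> r \<Longrightarrow> \<bar>avg M f (ball x r)\<bar> \<le> N"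
  using abs_avg_le[OF f_loc] avg_large order_trans by blast

lemma A_power_N: "N \<le> A ^ i * N" "i \<le> j \<Longrightarrow> A ^ i * N \<le> A ^ j * N"
  using A_ge_1 N_pos by (auto intro: power_increasing)

text \<open>The ball about \<open>x\<close> of radius \<open>\<rho> x / 2\<close> is outside \<open>\<D>\<close>, but its double is in \<open>\<D>\<close>.\<close>

lemma maximal_fun_lower: "ereal (- (2 * A * N)) \<le> Mf x"
proof -
  have "\<bar>avg M f (ball x (\<rho> x / 2)) - avg M f (ball x (\<rho> x))\<bar> \<le> A ^ 1 * N"
    using \<rho>_pos[of x] by (intro avg_compare_power) auto
  then have "- (2 * A * N) \<le> avg M f (ball x (\<rho> x / 2))"
    using abs_avg_large[of x "\<rho> x"] A_power_N(1)[of 1] by (simp add: abs_le_iff)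
  also have "ereal \<dots> \<le> Mf x"
    using \<rho>_pos[of x] by (intro avg_le_maximal_fun) auto
  finally show ?thesis by simp
qed

text \<open>The maximal function is lower semicontinuous: its superlevel sets are unions of balls.\<close>

lemma maximal_fun_measurable [measurable]: "Mf \<in> borel_measurable M"
proof (rule borel_measurableI_greater)
  fix a
  have "{x. a < Mf x} = (\<Union>(z, r)\<in>{(z, r). 0 < r \<and> r < \<rho> z \<and> a < ereal (avg M f (ball z r))}. ball z r)"
    unfolding less_maximal_fun_iff by fastforce
  then have "open {x. a < Mf x}" by auto
  then show "{x \<in> space M. a < Mf x} \<in> sets M"
    by (simp add: space_M open_sets)
qed

text \<open>Every ball that competes at \<open>x\<close> has radius at most \<open>2 ^ k * R\<close>, hence competes in the local
  maximal function of the dilated ball, whose own average of \<open>f\<close> is bounded by \<open>N\<close>.\<close>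

lemma maximal_fun_upper_large:
  assumes R: "\<rho> z \<le> R" "x \<in> ball z R" and fin: "local_max z (2 ^ k * R) x < \<infinity>"
  shows "Mf x \<le> ereal (2 * A * N + enn2real (local_max z (2 ^ k * R) x))"
proof (rule maximal_fun_leI)
  fix w q assume wq: "0 < q" "q < \<rho> w" "x \<in> ball w q"
  let ?S = "2 ^ k * R"
  have "0 < R" using R \<rho>_pos[of z] by simp
  then have "1 * R \<le> ?S" by (intro mult_right_mono) auto
  then have "\<rho> z \<le> ?S" using R by simp
  then have "\<bar>avg M f (ball z ?S)\<bar> \<le> N" by (rule abs_avg_large)
  moreover have "\<bar>avg M f (ball w q) - avg M f (ball z ?S)\<bar> \<le> enn2real (local_max z ?S x)"
    using wq fin radius[OF R wq(3,2)] by (intro avg_diff_le_local_max)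
  moreover have "N \<le> 2 * A * N"
    using mult_right_mono[of 1 "2 * A" N] A_ge_1 N_pos by simp
  ultimately have "avg M f (ball w q) \<le> 2 * A * N + enn2real (local_max z ?S x)"
    by linarith
  then show "ereal (avg M f (ball w q)) \<le> ereal (2 * A * N + enn2real (local_max z ?S x))"
    by simp
qed

text \<open>A Harnack-type comparison on balls outside \<open>\<D>\<close>. Each competitor at \<open>x\<close> is matched by a number
  \<open>b\<close> below the maximal function at \<open>y\<close>: the average over the given ball if the competitor is
  small, the average over its fourfold dilation if that is still outside \<open>\<D>\<close>, and otherwise the
  universal lower bound, because averages over balls in \<open>\<D>\<close> are bounded by \<open>N\<close>.\<close>

lemma maximal_fun_upper_small:
  assumes R: "0 < R" "R < \<rho> z" and x: "x \<in> ball z R" and y: "y \<in> ball z R"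
    and fin: "local_max z R x < \<infinity>"
  shows "Mf x \<le> Mf y + ereal (4 * A ^ 2 * N + enn2real (local_max z R x))"
proof (rule maximal_fun_leI)
  fix w q assume wq: "0 < q" "q < \<rho> w" "x \<in> ball w q"
  let ?m = "enn2real (local_max z R x)"
  have N': "N \<le> A ^ 2 * N" "A * N \<le> A ^ 2 * N" "0 < A ^ 2 * N"
    using A_power_N(1)[of 2] A_power_N(2)[of 1 2] N_pos A_pos by auto
  have "\<exists>b. ereal b \<le> Mf y \<and> avg M f (ball w q) \<le> b + (4 * A ^ 2 * N + ?m)"
  proof (cases "q \<le> R")
    case True
    have "ereal (avg M f (ball z R)) \<le> Mf y"
      using R y by (intro avg_le_maximal_fun)
    moreover have "\<bar>avg M f (ball w q) - avg M f (ball z R)\<bar> \<le> ?m"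
      using wq fin True by (intro avg_diff_le_local_max)
    ultimately show ?thesis
      using N' N_pos by (intro exI[of _ "avg M f (ball z R)"] conjI) linarith+
  next
    case False
    have "\<bar>avg M f (ball w q) - avg M f (ball w (4 * q))\<bar> \<le> A ^ 2 * N"
      using wq by (intro avg_compare_power) auto
    then have 1: "avg M f (ball w q) \<le> avg M f (ball w (4 * q)) + A ^ 2 * N" by linarith
    have m: "0 \<le> ?m" by simp
    show ?thesis
    proof (cases "4 * q < \<rho> w")
      case True
      have "dist w y \<le> dist w x + dist x z + dist z y"
        using dist_triangle[of w y x] dist_triangle[of x y z] by linarith
      then have "y \<in> ball w (4 * q)"
        using x y wq False by (simp add: dist_commute)
      then have "ereal (avg M f (ball w (4 * q))) \<le> Mf y"
        using wq True by (intro avg_le_maximal_fun) auto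
      then show ?thesis using 1 m N' by (intro exI[of _ "avg M f (ball w (4 * q))"] conjI) linarith+
    next
      case large: False
      have "\<bar>avg M f (ball w (4 * q))\<bar> \<le> N"
        using large by (intro abs_avg_large) simp
      then have "avg M f (ball w q) \<le> - (2 * A * N) + (4 * A ^ 2 * N + ?m)"
        using 1 m N' by linarith
      then show ?thesis using maximal_fun_lower by blast
    qed
  qed
  then obtain b where "ereal b \<le> Mf y" "avg M f (ball w q) \<le> b + (4 * A ^ 2 * N + ?m)" by blast
  then show "ereal (avg M f (ball w q)) \<le> Mf y + ereal (4 * A ^ 2 * N + ?m)"
    by (cases "Mf y") auto
qed

lemma nn_avg_maximal_fun_large:
  assumes "\<rho> z \<le> R"
  shows "nn_avg M (\<lambda>y. ennreal \<bar>F y\<bar>) (ball z R) \<le> ennreal (2 * A * N + 8 * A ^ (7 + k) * N)"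
proof (rule nn_avg_le_of_local_max)
  show "0 < R" using assms \<rho>_pos[of z] by simp
  have AN: "0 \<le> 2 * A * N" using A_pos N_pos by simp
  then show "0 \<le> 2 * A * N" .
  have "ennreal \<bar>F y\<bar> \<le> ennreal (2 * A * N) + local_max z (2 ^ k * R) y" if y: "y \<in> ball z R" for y
  proof (cases "local_max z (2 ^ k * R) y < \<infinity>")
    case True
    let ?m = "enn2real (local_max z (2 ^ k * R) y)"
    have "Mf y \<le> ereal (2 * A * N + ?m)"
      using True y assms by (intro maximal_fun_upper_large)
    with maximal_fun_lower[of y] have "\<bar>F y\<bar> \<le> 2 * A * N + ?m"
      by (cases "Mf y") (auto simp: abs_le_iff add_increasing2)
    then have "ennreal \<bar>F y\<bar> \<le> ennreal (2 * A * N + ?m)" by (rule ennreal_leI)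
    also have "\<dots> = ennreal (2 * A * N) + local_max z (2 ^ k * R) y"
      using AN True by simp
    finally show ?thesis .
  next
    case False
    then show ?thesis by (simp add: less_top[symmetric])
  qed
  then show "AE y in M. y \<in> ball z R \<longrightarrow> ennreal \<bar>F y\<bar> \<le> ennreal (2 * A * N) + local_max z (2 ^ k * R) y"
    by simp
qed

text \<open>Balls about one point with radius at least \<open>\<rho> x0\<close> belong to \<open>\<D>\<close> and exhaust the space.\<close>

lemma AE_maximal_fun_finite: "AE x in M. \<bar>Mf x\<bar> \<noteq> \<infinity>"
proof -
  fix x0 :: 'a
  let ?R = "\<lambda>n. \<rho> x0 + real n"
  have "AE x in M. x \<in> ball x0 (?R n) \<longrightarrow> \<bar>Mf x\<bar> \<noteq> \<infinity>" for n
  proof -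
    have R: "0 < ?R n" using \<rho>_pos[of x0] by simp
    then have "0 < 2 ^ k * ?R n" and sub: "ball x0 (?R n) \<subseteq> ball x0 (2 ^ k * ?R n)"
      by (auto intro!: subset_ball)
    then have "AE x in M. x \<in> ball x0 (2 ^ k * ?R n) \<longrightarrow> local_max x0 (2 ^ k * ?R n) x < \<infinity>"
      by (intro AE_local_max_finite)
    then show ?thesis
    proof eventually_elim
      case (elim x)
      show ?case
      proof
        assume x: "x \<in> ball x0 (?R n)"
        then have "local_max x0 (2 ^ k * ?R n) x < \<infinity>" using sub elim by blast
        then have "Mf x \<le> ereal (2 * A * N + enn2real (local_max x0 (2 ^ k * ?R n) x))"
          using x by (intro maximal_fun_upper_large) auto
        then show "\<bar>Mf x\<bar> \<noteq> \<infinity>"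
          using maximal_fun_lower[of x] by (cases "Mf x") auto
      qed
    qed
  qed
  then have "AE x in M. \<forall>n. x \<in> ball x0 (?R n) \<longrightarrow> \<bar>Mf x\<bar> \<noteq> \<infinity>"
    unfolding AE_all_countable by blast
  then show ?thesis
  proof eventually_elim
    case (elim x)
    obtain n where "dist x0 x < real n"
      using reals_Archimedean2 by blast
    then have "dist x0 x < ?R n" using \<rho>_pos[of x0] by linarith
    then have "x \<in> ball x0 (?R n)" by simp
    then show ?case by (rule elim[rule_format])
  qed
qed

text \<open>The comparison of the values at \<open>x\<close> and \<open>y\<close> becomes a lower bound for the essential infimum,
  as the real-valued version differs from the maximal function only on a null set.\<close>

lemma nn_avg_maximal_fun_small:
  assumes R: "0 < R" "R < \<rho> z"
  shows "nn_avg M (\<lambda>y. e2ennreal (ereal (F y) - ess_inf M (ball z R) F)) (ball z R)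
     \<le> ennreal (4 * A ^ 2 * N + 8 * A ^ (7 + 0) * N)"
proof (rule nn_avg_le_of_local_max)
  show "0 < R" by fact
  have AN: "0 \<le> 4 * A ^ 2 * N" using A_pos N_pos by simp
  then show "0 \<le> 4 * A ^ 2 * N" .
  show "AE x in M. x \<in> ball z R \<longrightarrow> e2ennreal (ereal (F x) - ess_inf M (ball z R) F)
      \<le> ennreal (4 * A ^ 2 * N) + local_max z (2 ^ 0 * R) x"
    using AE_maximal_fun_finite
  proof eventually_elim
    case (elim x)
    show ?case
    proof
      assume x: "x \<in> ball z R"
      show "e2ennreal (ereal (F x) - ess_inf M (ball z R) F)
          \<le> ennreal (4 * A ^ 2 * N) + local_max z (2 ^ 0 * R) x"
      proof (cases "local_max z R x < \<infinity>")
        case True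
        let ?m = "enn2real (local_max z R x)"
        let ?c = "4 * A ^ 2 * N + ?m"
        have "AE y in M. y \<in> ball z R \<longrightarrow> ereal (F x - ?c) \<le> ereal (F y)"
          using AE_maximal_fun_finite
        proof eventually_elim
          case fin_y: (elim y)
          show ?case
          proof
            assume "y \<in> ball z R"
            then have "Mf x \<le> Mf y + ereal ?c"
              using R x True by (intro maximal_fun_upper_small)
            then show "ereal (F x - ?c) \<le> ereal (F y)"
              using elim fin_y by (cases "Mf x"; cases "Mf y") auto
          qed
        qed
        then have "ereal (F x - ?c) \<le> ess_inf M (ball z R) F"
          unfolding ess_inf_def by (intro Sup_upper) simp
        then have "ereal (F x) - ess_inf M (ball z R) F \<le> ereal ?c"
          by (cases "ess_inf M (ball z R) F") auto
        then have "e2ennreal (ereal (F x) - ess_inf M (ball z R) F) \<le> ennreal ?c"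
          using e2ennreal_mono by fastforce
        also have "\<dots> = ennreal (4 * A ^ 2 * N) + local_max z R x"
          using AN True by simp
        finally show ?thesis by simp
      next
        case False
        then show ?thesis by (simp add: less_top[symmetric])
      qed
    qed
  qed
qed

text \<open>Any ball is contained in a concentric one in \<open>\<D>\<close>, where the average of the absolute value is
  finite.\<close>

lemma maximal_fun_L1_loc: "F \<in> L1_loc M"
proof -
  have "set_integrable M (ball x r) F" if "0 < r" for x r
  proof -
    let ?R = "max r (\<rho> x)"
    have R: "0 < ?R" using that by simp
    have "nn_avg M (\<lambda>y. ennreal \<bar>F y\<bar>) (ball x ?R) \<noteq> \<infinity>"
      using nn_avg_maximal_fun_large[of x ?R] by (auto simp: top_unique)
    then have "(\<integral>\<^sup>+y\<in>ball x ?R. ennreal \<bar>F y\<bar> \<partial>M) \<noteq> \<infinity>"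
      using ball_fin[OF R, of x] unfolding nn_avg_def
      by (metis ennreal_top_divide infinity_ennreal_def less_irrefl)
    moreover have "(\<integral>\<^sup>+y\<in>ball x ?R. ennreal \<bar>F y\<bar> \<partial>M)
        = (\<integral>\<^sup>+y. ennreal (norm (indicator (ball x ?R) y *\<^sub>R F y)) \<partial>M)"
      by (intro nn_integral_cong) (auto split: split_indicator)
    ultimately have "set_integrable M (ball x ?R) F"
      unfolding set_integrable_def by (intro integrableI_bounded) (auto simp: less_top)
    then show ?thesis
      by (rule set_integrable_subset) (auto intro!: subset_ball)
  qed
  then show ?thesis by (auto simp: L1_loc_def balls_def)
qed

lemma BLO_norm_maximal_fun:
  "BLO_norm M \<rho> F \<le> ennreal ((4 * A ^ 2 + 8 * A ^ 7 + 2 * A + 8 * A ^ (7 + k)) * N)"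
proof -
  have "BLO_norm M \<rho> F \<le> ennreal (4 * A ^ 2 * N + 8 * A ^ (7 + 0) * N)
       + ennreal (2 * A * N + 8 * A ^ (7 + k) * N)"
    unfolding BLO_norm_def
  proof (intro add_mono SUP_least)
    fix B assume "B \<in> balls - coll_D \<rho>"
    then obtain z R where "B = (z, R)" "0 < R" "R < \<rho> z"
      by (cases B) (auto simp: coll_D_def balls_def not_le)
    then show "(case B of (x, r) \<Rightarrow> nn_avg M (\<lambda>y. e2ennreal (ereal (F y) - ess_inf M (ball x r) F)) (ball x r))
        \<le> ennreal (4 * A ^ 2 * N + 8 * A ^ (7 + 0) * N)"
      using nn_avg_maximal_fun_small by simp
  next
    fix B assume "B \<in> coll_D \<rho>"
    then obtain z R where "B = (z, R)" "\<rho> z \<le> R"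
      by (auto simp: coll_D_def)
    then show "(case B of (x, r) \<Rightarrow> nn_avg M (\<lambda>y. ennreal \<bar>F y\<bar>) (ball x r))
        \<le> ennreal (2 * A * N + 8 * A ^ (7 + k) * N)"
      using nn_avg_maximal_fun_large by simp
  qed
  also have "\<dots> = ennreal ((4 * A ^ 2 + 8 * A ^ 7 + 2 * A + 8 * A ^ (7 + k)) * N)"
    using A_nonneg N_pos by (subst ennreal_plus[symmetric]) (auto simp: algebra_simps)
  finally show ?thesis .
qed

end

section \<open>Boundedness from BMO to BLO\<close>

context doubling_space begin

lemma BMO_avg_bounds:
  assumes f: "f \<in> BMO M \<rho>" and \<rho>: "\<And>x. 0 < \<rho> x"
  shows "0 < r \<Longrightarrow> avg M (\<lambda>y. \<bar>f y - avg M f (ball x r)\<bar>) (ball x r) \<le> 2 * enn2real (BMO_norm M \<rho> f)"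
    and "\<rho> x \<le> r \<Longrightarrow> avg M (\<lambda>y. \<bar>f y\<bar>) (ball x r) \<le> enn2real (BMO_norm M \<rho> f)"
proof -
  let ?b = "enn2real (BMO_norm M \<rho> f)"
  have loc: "f \<in> L1_loc M" and fin: "BMO_norm M \<rho> f < \<infinity>"
    using f by (auto simp: BMO_def)
  have b: "BMO_norm M \<rho> f = ennreal ?b" using fin by simp
  show large: "avg M (\<lambda>y. \<bar>f y\<bar>) (ball x r) \<le> ?b" if "\<rho> x \<le> r" for x r
  proof -
    have r: "0 < r" using that \<rho>[of x] by simp
    have "nn_avg M (\<lambda>y. ennreal \<bar>f y\<bar>) (ball x r)
       \<le> (SUP (x, r)\<in>coll_D \<rho>. nn_avg M (\<lambda>y. ennreal \<bar>f y\<bar>) (ball x r))"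
      using that r by (intro SUP_upper2[where i="(x, r)"]) (auto simp: coll_D_def balls_def)
    also have "\<dots> \<le> BMO_norm M \<rho> f" by (simp add: BMO_norm_def)
    finally show ?thesis
      using loc r by (subst (asm) b) (simp add: nn_avg_eq_avg)
  qed
  show "avg M (\<lambda>y. \<bar>f y - avg M f (ball x r)\<bar>) (ball x r) \<le> 2 * ?b" if r: "0 < r"
  proof (cases "\<rho> x \<le> r")
    case True
    have "avg M (\<lambda>y. \<bar>f y - avg M f (ball x r)\<bar>) (ball x r)
       \<le> avg M (\<lambda>y. \<bar>f y - 0\<bar>) (ball x r) + \<bar>0 - avg M f (ball x r)\<bar>"
      using loc r by (rule avg_abs_change_const)
    then show ?thesis
      using large[OF True] abs_avg_le[OF loc, of x r] by simp
  next
    case False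
    have "nn_avg M (\<lambda>y. ennreal \<bar>f y - avg M f (ball x r)\<bar>) (ball x r)
       \<le> (SUP (x, r)\<in>balls - coll_D \<rho>.
            nn_avg M (\<lambda>y. ennreal \<bar>f y - avg M f (ball x r)\<bar>) (ball x r))"
      using False r by (intro SUP_upper2[where i="(x, r)"]) (auto simp: coll_D_def balls_def)
    also have "\<dots> \<le> BMO_norm M \<rho> f" by (simp add: BMO_norm_def)
    finally have "avg M (\<lambda>y. \<bar>f y - avg M f (ball x r)\<bar>) (ball x r) \<le> ?b"
      using loc r by (subst (asm) b) (simp add: nn_avg_eq_avg)
    then show ?thesis using enn2real_nonneg[of "BMO_norm M \<rho> f"] by linarith
  qed
qed

end

lemma RD_space_doubling:
  assumes "RD_space M" obtains A where "doubling_space M A"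
proof -
  have reg: "sets M = sets borel"
    and ball: "\<And>x r. 0 < r \<Longrightarrow> 0 < emeasure M (ball x r) \<and> emeasure M (ball x r) < \<infinity>"
    using assms by (auto simp: RD_space_def regular_borel_measure_def)
  obtain A where "A \<ge> 1" "\<And>x r. r > 0 \<Longrightarrow> measure M (ball x (2 * r)) \<le> A * measure M (ball x r)"
    using assms by (auto simp: RD_space_def doubling_measure_def)
  then have "doubling_space M A"
    using reg ball by unfold_locales auto
  then show ?thesis by (rule that)
qed

theorem theorem4p1:
  fixes M :: "'a::metric_space measure" and \<rho> :: "'a \<Rightarrow> real"
  assumes "RD_space M" and "admissible \<rho>"
  shows "\<exists>C::real. C > 0 \<and>
    (\<forall>f\<in>BMO M \<rho>.
       (AE x in M. \<bar>maximal_fun M \<rho> f x\<bar> \<noteq> \<infinity>) \<and>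
       (\<lambda>x. real_of_ereal (maximal_fun M \<rho> f x)) \<in> BLO M \<rho> \<and>
       BLO_norm M \<rho> (\<lambda>x. real_of_ereal (maximal_fun M \<rho> f x)) \<le> ennreal C * BMO_norm M \<rho> f)"
proof -
  obtain A where "doubling_space M A"
    using RD_space_doubling[OF assms(1)] .
  then interpret doubling_space M A .
  obtain k :: nat where k: "\<And>z r x w q. \<rho> z \<le> r \<Longrightarrow> x \<in> ball z r \<Longrightarrow> x \<in> ball w q \<Longrightarrow> q < \<rho> w
      \<Longrightarrow> q \<le> 2 ^ k * r"
    using admissible_radius_bound[OF assms(2)] by blast
  have \<rho>: "0 < \<rho> x" for x
    using assms(2) by (auto simp: admissible_def)
  define C where "C = 4 * A ^ 2 + 8 * A ^ 7 + 2 * A + 8 * A ^ (7 + k)"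
  have C: "0 < C"
    using A_pos by (simp add: C_def add_pos_pos)
  have main: "(AE x in M. \<bar>maximal_fun M \<rho> f x\<bar> \<noteq> \<infinity>) \<and>
       (\<lambda>x. real_of_ereal (maximal_fun M \<rho> f x)) \<in> BLO M \<rho> \<and>
       BLO_norm M \<rho> (\<lambda>x. real_of_ereal (maximal_fun M \<rho> f x)) \<le> ennreal (2 * C) * BMO_norm M \<rho> f"
    if f: "f \<in> BMO M \<rho>" for f
  proof -
    let ?F = "\<lambda>x. real_of_ereal (maximal_fun M \<rho> f x)"
    define b where "b = enn2real (BMO_norm M \<rho> f)"
    have b: "0 \<le> b" "BMO_norm M \<rho> f = ennreal b"
      using f by (auto simp: b_def BMO_def)
    \<comment> \<open>The summand \<open>e\<close> keeps the bound positive; it is sent to zero at the end.\<close>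
    have bmo: "bmo_rho M A f (2 * b + e) \<rho> k" if e: "0 < e" for e
    proof unfold_locales
      show "f \<in> L1_loc M" using f by (simp add: BMO_def)
      show "0 < 2 * b + e" using b e by simp
      show "avg M (\<lambda>y. \<bar>f y - avg M f (ball x r)\<bar>) (ball x r) \<le> 2 * b + e" if "0 < r" for x r
        using BMO_avg_bounds(1)[OF f \<rho> that, of x] e b(1) by (simp add: b_def)
      show "avg M (\<lambda>y. \<bar>f y\<bar>) (ball x r) \<le> 2 * b + e" if "\<rho> x \<le> r" for x r
        using BMO_avg_bounds(2)[OF f \<rho> that] e b(1) unfolding b_def by linarith
      show "0 < \<rho> x" for x by (fact \<rho>)
      show "q \<le> 2 ^ k * r" if "\<rho> z \<le> r" "x \<in> ball z r" "x \<in> ball w q" "q < \<rho> w" for z r x w q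
        using that by (rule k)
    qed
    have "BLO_norm M \<rho> ?F \<le> ennreal (2 * C * b)"
    proof (rule ennreal_le_epsilon)
      fix e :: real assume e: "0 < e"
      then have "BLO_norm M \<rho> ?F \<le> ennreal (C * (2 * b + e / C))"
        using bmo_rho.BLO_norm_maximal_fun[OF bmo[of "e / C"]] C unfolding C_def by simp
      also have "C * (2 * b + e / C) = 2 * C * b + e"
        using C by (simp add: field_simps)
      also have "ennreal (2 * C * b + e) = ennreal (2 * C * b) + ennreal e"
        using C e b(1) by (intro ennreal_plus) auto
      finally show "BLO_norm M \<rho> ?F \<le> ennreal (2 * C * b) + ennreal e" .
    qed
    moreover have "ennreal (2 * C) * BMO_norm M \<rho> f = ennreal (2 * C * b)"
      using C b by (simp add: ennreal_mult)
    moreover have "?F \<in> L1_loc M" "AE x in M. \<bar>maximal_fun M \<rho> f x\<bar> \<noteq> \<infinity>"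
      using bmo_rho.maximal_fun_L1_loc bmo_rho.AE_maximal_fun_finite bmo[of 1] by auto
    ultimately show ?thesis
      by (auto simp: BLO_def intro: le_less_trans)
  qed
  show ?thesis
    using C main by (intro exI[of _ "2 * C"]) simp
qed

end
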